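(* Let $p$ be a prime and let $G$ be a finite nonabelian $p$-group that is an $F$-group. Then every vertex of the centralizer graph $\Gamma_{\mathcal{Z}}(G)$ has degree congruent to $0$ modulo $p$.
   Context: For $g$ in a group $G$, $\mathbf{C}_G(g)$ is the centralizer of $g$ in $G$, and $\mathbf{Z}(K)$ denotes the center of a group $K$. Let $\mathcal{C}(G)=\{\mathbf{C}_G(g)\mid g\in G\setminus\mathbf{Z}(G)\}$ (a set of subgroups). The centralizer graph $\Gamma_{\mathcal{Z}}(G)$ is the simple undirected graph with vertex set $\mathcal{C}(G)$ in which distinct vertices $\mathbf{C}_G(g)$ and $\mathbf{C}_G(h)$ are joined by an edge if and only if $\mathbf{Z}(\mathbf{C}_G(h))\subseteq \mathbf{C}_G(g)$ (this condition is symmetric in $g$ and $h$). A group $G$ is an $F$-group if whenever $\mathbf{C}_G(g)$ and $\mathbf{C}_G(h)$ are distinct members of $\mathcal{C}(G)$, neither $\mathbf{C}_G(g)$ contains $\mathbf{C}_G(h)$ nor $\mathbf{C}_G(h)$ contains $\mathbf{C}_G(g)$. *)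

theory Defs
  imports
    "HOL-Algebra.Coset"
    "HOL-Number_Theory.Cong"
    "Graph_Theory.Pair_Digraph"
begin

definition elt_centralizer :: "('a, 'b) monoid_scheme \<Rightarrow> 'a \<Rightarrow> 'a set" where
  "elt_centralizer G g = {x \<in> carrier G. x \<otimes>\<^bsub>G\<^esub> g = g \<otimes>\<^bsub>G\<^esub> x}"

definition group_center :: "('a, 'b) monoid_scheme \<Rightarrow> 'a set" where
  "group_center G = {z \<in> carrier G. \<forall>x \<in> carrier G. z \<otimes>\<^bsub>G\<^esub> x = x \<otimes>\<^bsub>G\<^esub> z}"

definition centralizers :: "('a, 'b) monoid_scheme \<Rightarrow> 'a set set" where
  "centralizers G = elt_centralizer G ` (carrier G - group_center G)"

definition F_group :: "('a, 'b) monoid_scheme \<Rightarrow> bool" where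
  "F_group G \<longleftrightarrow> group G \<and>
     (\<forall>A \<in> centralizers G. \<forall>B \<in> centralizers G. A \<noteq> B \<longrightarrow> \<not> B \<subseteq> A \<and> \<not> A \<subseteq> B)"

definition finite_p_group :: "nat \<Rightarrow> ('a, 'b) monoid_scheme \<Rightarrow> bool" where
  "finite_p_group p G \<longleftrightarrow> group G \<and> finite (carrier G) \<and> (\<exists>n. order G = p ^ n)"

text \<open>
  A simple undirected graph is represented, as in \<^locale>\<open>pair_graph\<close>, by a finite
  loop-free digraph with a symmetric set of arcs: an edge between \<open>A\<close> and \<open>B\<close> is the pair of
  arcs \<open>(A, B)\<close>, \<open>(B, A)\<close>. The degree of a vertex in the undirected graph is therefore its
  out-degree. Lemma \<open>pair_graph_centralizer_graph\<close> below shows that the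
  adjacency condition is indeed symmetric.
\<close>

definition centralizer_graph :: "('a, 'b) monoid_scheme \<Rightarrow> 'a set pair_pre_digraph" where
  "centralizer_graph G =
     \<lparr> pverts = centralizers G,
       parcs = {(A, B). A \<in> centralizers G \<and> B \<in> centralizers G \<and> A \<noteq> B \<and>
                        group_center (G\<lparr>carrier := B\<rparr>) \<subseteq> A} \<rparr>"

lemma center_centralizer_subset_iff:
  assumes "g \<in> carrier G" "h \<in> carrier G"
  shows "group_center (G\<lparr>carrier := elt_centralizer G h\<rparr>) \<subseteq> elt_centralizer G g
           \<longleftrightarrow> g \<otimes>\<^bsub>G\<^esub> h = h \<otimes>\<^bsub>G\<^esub> g"
proof
  assume "group_center (G\<lparr>carrier := elt_centralizer G h\<rparr>) \<subseteq> elt_centralizer G g"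
  moreover have "h \<in> group_center (G\<lparr>carrier := elt_centralizer G h\<rparr>)"
    using assms by (auto simp: group_center_def elt_centralizer_def)
  ultimately show "g \<otimes>\<^bsub>G\<^esub> h = h \<otimes>\<^bsub>G\<^esub> g"
    by (auto simp: elt_centralizer_def)
next
  assume "g \<otimes>\<^bsub>G\<^esub> h = h \<otimes>\<^bsub>G\<^esub> g"
  with assms show "group_center (G\<lparr>carrier := elt_centralizer G h\<rparr>) \<subseteq> elt_centralizer G g"
    by (auto simp: group_center_def elt_centralizer_def)
qed

lemma pair_graph_centralizer_graph:
  assumes "finite (carrier G)"
  shows "pair_graph (centralizer_graph G)"
proof
  show "finite (pverts (centralizer_graph G))"
    using assms by (simp add: centralizer_graph_def centralizers_def)
  have "parcs (centralizer_graph G) \<subseteq> centralizers G \<times> centralizers G"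
    by (auto simp: centralizer_graph_def)
  then show "finite (parcs (centralizer_graph G))"
    by (rule finite_subset) (use assms in \<open>simp add: centralizers_def\<close>)
next
  show "symmetric (with_proj (centralizer_graph G))"
    unfolding symmetric_def
  proof (rule symI)
    fix A B
    assume "(A, B) \<in> arcs_ends (with_proj (centralizer_graph G))"
    then have AB: "A \<in> centralizers G" "B \<in> centralizers G" "A \<noteq> B"
        "group_center (G\<lparr>carrier := B\<rparr>) \<subseteq> A"
      by (auto simp: centralizer_graph_def)
    then obtain g h where gh: "A = elt_centralizer G g" "B = elt_centralizer G h"
        "g \<in> carrier G" "h \<in> carrier G"
      by (auto simp: centralizers_def)
    with AB(4) have "group_center (G\<lparr>carrier := A\<rparr>) \<subseteq> B"
      by (simp add: center_centralizer_subset_iff)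
    with AB show "(B, A) \<in> arcs_ends (with_proj (centralizer_graph G))"
      by (auto simp: centralizer_graph_def)
  qed
qed (auto simp: centralizer_graph_def)

end

theory Submission
  imports Defs
begin

text \<open>
  In an \<open>F\<close>-group a noncentral element \<open>x\<close> lies in \<open>Z(C(h))\<close> for a noncentral \<open>h\<close> only if
  \<open>C(x) = C(h)\<close>: centrality in \<open>C(h)\<close> gives \<open>C(h) \<subseteq> C(x)\<close>, and proper containments are excluded.
  So the sets \<open>Z(B) - Z(G)\<close>, for \<open>B\<close> ranging over the vertices, are the fibres of \<open>x \<mapsto> C(x)\<close> on the
  noncentral elements (\<open>F_group_center_vertex_eq\<close>). Those fibres that meet a vertex \<open>A\<close> outside
  \<open>Z(A)\<close> belong precisely to the neighbours of \<open>A\<close>, and they lie in \<open>A\<close> entirely. Counting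
  \<open>A - Z(A)\<close> along this partition gives, with \<open>N\<close> the set of neighbours,
  \<open>|A| + |N| |Z(G)| = |Z(A)| + (\<Sum>B\<in>N. |Z(B)|)\<close>  (\<open>F_group_vertex_count\<close>).

  In a \<open>p\<close>-group, each of \<open>A\<close>, \<open>Z(A)\<close> and \<open>Z(B)\<close> is a subgroup that properly contains \<open>Z(G)\<close>, so
  its order is divisible by \<open>p |Z(G)|\<close> (\<open>p_group_dvd_card_proper\<close>). Hence \<open>p |Z(G)|\<close> divides
  \<open>|N| |Z(G)|\<close>, that is, \<open>p\<close> divides the degree \<open>|N|\<close>.
\<close>

lemma subgroup_set_centralizer:
  fixes G (structure)
  assumes "group G" "S \<subseteq> carrier G"
  shows "subgroup {x \<in> carrier G. \<forall>s\<in>S. x \<otimes> s = s \<otimes> x} G"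
proof -
  interpret group G by fact
  show ?thesis
  proof (rule subgroupI, goal_cases)
    case 2
    have "\<one> \<in> {x \<in> carrier G. \<forall>s\<in>S. x \<otimes> s = s \<otimes> x}"
      using assms(2) by auto
    then show ?case by blast
  next
    case (3 a)
    have "inv a \<otimes> s = s \<otimes> inv a" if "s \<in> S" for s
    proof -
      have s: "s \<in> carrier G" and a: "a \<in> carrier G" and c: "a \<otimes> s = s \<otimes> a"
        using 3 that assms(2) by auto
      have "inv a \<otimes> s = inv a \<otimes> (s \<otimes> a) \<otimes> inv a"
        using s a by (simp add: m_assoc)
      also have "\<dots> = s \<otimes> inv a"
        using s a by (simp add: c[symmetric] m_assoc[symmetric])
      finally show ?thesis .
    qed
    then show ?case using 3 by simp
  next
    case (4 a b)
    have "a \<otimes> b \<otimes> s = s \<otimes> (a \<otimes> b)" if "s \<in> S" for s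
    proof -
      have [simp]: "s \<in> carrier G" "a \<in> carrier G" "b \<in> carrier G"
        and c: "a \<otimes> s = s \<otimes> a" "b \<otimes> s = s \<otimes> b"
        using 4 that assms(2) by auto
      have "a \<otimes> b \<otimes> s = a \<otimes> s \<otimes> b" by (simp add: m_assoc c(2))
      also have "\<dots> = s \<otimes> (a \<otimes> b)" by (simp add: m_assoc c(1))
      finally show ?thesis .
    qed
    then show ?case using 4 by simp
  qed auto
qed

lemma subgroup_elt_centralizer:
  assumes "group G" "g \<in> carrier G"
  shows "subgroup (elt_centralizer G g) G"
  using subgroup_set_centralizer[OF assms(1), of "{g}"] assms(2)
  by (simp add: elt_centralizer_def)

lemma subgroup_center_of_subgroup:
  assumes "group G" "subgroup H G"
  shows "subgroup (group_center (G\<lparr>carrier := H\<rparr>)) G"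
proof -
  have "H \<subseteq> carrier G" by (rule subgroup.subset) fact
  then have "group_center (G\<lparr>carrier := H\<rparr>) =
      H \<inter> {x \<in> carrier G. \<forall>s\<in>H. x \<otimes>\<^bsub>G\<^esub> s = s \<otimes>\<^bsub>G\<^esub> x}"
    by (auto simp: group_center_def)
  then show ?thesis
    using group.subgroups_Inter_pair[OF assms(1,2) subgroup_set_centralizer[OF assms(1)]]
      \<open>H \<subseteq> carrier G\<close> by simp
qed

lemma group_center_subset_center_centralizer:
  assumes "g \<in> carrier G"
  shows "group_center G \<subseteq> group_center (G\<lparr>carrier := elt_centralizer G g\<rparr>)"
  using assms by (auto simp: group_center_def elt_centralizer_def)

lemma elt_in_center_centralizer:
  assumes "g \<in> carrier G"
  shows "g \<in> group_center (G\<lparr>carrier := elt_centralizer G g\<rparr>)"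
  using assms by (auto simp: group_center_def elt_centralizer_def)

text \<open>
  This is the only place where the \<open>F\<close>-group property enters: an element central in the
  vertex \<open>B\<close> has a centralizer containing \<open>B\<close>, which by incomparability must be \<open>B\<close> itself.
\<close>

lemma F_group_center_vertex_eq:
  assumes "F_group G" "B \<in> centralizers G"
  shows "group_center (G\<lparr>carrier := B\<rparr>) - group_center G =
    {x \<in> carrier G - group_center G. elt_centralizer G x = B}" (is "?L = ?R")
proof
  show "?L \<subseteq> ?R"
  proof
    fix x assume x: "x \<in> ?L"
    have "B \<subseteq> carrier G"
      using assms(2) by (auto simp: centralizers_def elt_centralizer_def)
    then have xc: "x \<in> carrier G - group_center G" and "B \<subseteq> elt_centralizer G x"
      using x by (auto simp: group_center_def elt_centralizer_def)
    moreover have "elt_centralizer G x \<in> centralizers G"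
      using xc by (simp add: centralizers_def)
    ultimately show "x \<in> ?R"
      using assms by (auto simp: F_group_def)
  qed
  show "?R \<subseteq> ?L"
    using elt_in_center_centralizer by fastforce
qed

text \<open>
  Neighbours of \<open>C(g)\<close> are the vertices \<open>C(h) \<noteq> C(g)\<close> with \<open>h \<in> C(g)\<close>, so they index exactly the
  fibres of \<open>x \<mapsto> C(x)\<close> that partition \<open>C(g)\<close> minus its centre. The identity is arranged
  without subtraction, to hold in \<^typ>\<open>nat\<close>.
\<close>

lemma F_group_vertex_count:
  fixes G :: "('a, 'b) monoid_scheme"
  assumes "F_group G" "finite (carrier G)" "A \<in> centralizers G"
  defines "N \<equiv> {B. (A, B) \<in> parcs (centralizer_graph G)}"
  shows "card A + card N * card (group_center G) =
    card (group_center (G\<lparr>carrier := A\<rparr>)) + (\<Sum>B\<in>N. card (group_center (G\<lparr>carrier := B\<rparr>)))"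
proof -
  let ?Z = "\<lambda>B. group_center (G\<lparr>carrier := B\<rparr>)"
  obtain g where g: "g \<in> carrier G" "A = elt_centralizer G g"
    using assms(3) by (auto simp: centralizers_def)
  have fin: "finite A"
    using assms(2) g by (simp add: elt_centralizer_def)
  have ZA: "?Z A \<subseteq> A" by (auto simp: group_center_def)
  have N_vertex: "B \<in> centralizers G" and N_neq: "B \<noteq> A" and N_center: "?Z B \<subseteq> A" if "B \<in> N" for B
    using that by (auto simp: N_def centralizer_graph_def)
  have finZ: "finite (?Z B)" if "B \<in> N" for B
    using N_center[OF that] fin by (rule finite_subset)
  have finN: "finite N"
    by (rule finite_subset[of _ "centralizers G"])
       (use N_vertex assms(2) in \<open>auto simp: centralizers_def\<close>)
  have Zsub: "group_center G \<subseteq> ?Z B" if "B \<in> centralizers G" for B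
    using that group_center_subset_center_centralizer by (fastforce simp: centralizers_def)
  note fibre = F_group_center_vertex_eq[OF assms(1)]
  have part: "A - ?Z A = (\<Union>B\<in>N. ?Z B - group_center G)"
  proof
    show "A - ?Z A \<subseteq> (\<Union>B\<in>N. ?Z B - group_center G)"
    proof
      fix x assume x: "x \<in> A - ?Z A"
      then have xc: "x \<in> carrier G - group_center G"
        using g Zsub[OF assms(3)] by (auto simp: elt_centralizer_def)
      let ?B = "elt_centralizer G x"
      have vB: "?B \<in> centralizers G" using xc by (simp add: centralizers_def)
      have ne: "?B \<noteq> A" using x xc fibre[OF assms(3)] by blast
      have "g \<otimes>\<^bsub>G\<^esub> x = x \<otimes>\<^bsub>G\<^esub> g"
        using x g by (auto simp: elt_centralizer_def)
      then have "?Z ?B \<subseteq> A"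
        using center_centralizer_subset_iff[of g G x] g xc by simp
      then have "?B \<in> N"
        using vB ne assms(3) by (auto simp: N_def centralizer_graph_def)
      then show "x \<in> (\<Union>B\<in>N. ?Z B - group_center G)"
        using xc fibre[OF vB] by blast
    qed
    show "(\<Union>B\<in>N. ?Z B - group_center G) \<subseteq> A - ?Z A"
    proof
      fix x assume "x \<in> (\<Union>B\<in>N. ?Z B - group_center G)"
      then obtain B where B: "B \<in> N" "x \<in> ?Z B - group_center G" by blast
      then have "elt_centralizer G x = B"
        using fibre[OF N_vertex] by blast
      then have "x \<notin> ?Z A"
        using B N_neq fibre[OF assms(3)] by blast
      then show "x \<in> A - ?Z A"
        using B N_center by blast
    qed
  qed
  have "card (A - ?Z A) = (\<Sum>B\<in>N. card (?Z B - group_center G))"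
    unfolding part
  proof (rule card_UN_disjoint)
    show "\<forall>B\<in>N. \<forall>C\<in>N. B \<noteq> C \<longrightarrow> (?Z B - group_center G) \<inter> (?Z C - group_center G) = {}"
      using fibre N_vertex by auto
  qed (use finN finZ in auto)
  moreover have "card A = card (?Z A) + card (A - ?Z A)"
    using ZA fin by (simp add: card_Diff_subset card_mono finite_subset)
  moreover have "(\<Sum>B\<in>N. card (?Z B)) =
      (\<Sum>B\<in>N. card (?Z B - group_center G) + card (group_center G))"
  proof (rule sum.cong)
    fix B assume B: "B \<in> N"
    show "card (?Z B) = card (?Z B - group_center G) + card (group_center G)"
      using Zsub[OF N_vertex[OF B]] finZ[OF B]
      by (simp add: card_Diff_subset card_mono finite_subset)
  qed simp
  ultimately show ?thesis by (simp add: sum.distrib)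
qed

lemma p_group_dvd_card_proper:
  assumes p: "Factorial_Ring.prime p" and "finite_p_group p G"
    and "subgroup K G" "subgroup H G" "K \<subset> H"
  shows "p * card K dvd card H"
proof -
  interpret group G using assms(2) by (simp add: finite_p_group_def)
  obtain n where fin: "finite (carrier G)" and n: "order G = p ^ n"
    using assms(2) by (auto simp: finite_p_group_def)
  have pow: "\<exists>k. card S = p ^ k" if "subgroup S G" for S
  proof -
    have "card S dvd p ^ n"
      using lagrange[OF that] n by (metis dvd_triv_right)
    then show ?thesis using divides_primepow_nat[OF p] by blast
  qed
  obtain k h where kh: "card K = p ^ k" "card H = p ^ h"
    using pow assms(3,4) by meson
  have "card K < card H"
    using assms(5) finite_subset[OF subgroup.subset[OF assms(4)] fin] by (rule psubset_card_mono[rotated])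
  then have "Suc k \<le> h"
    using kh prime_gt_1_nat[OF p] by simp
  then have "p ^ Suc k dvd p ^ h" by (rule le_imp_power_dvd)
  then show ?thesis by (simp add: kh)
qed

theorem theorem2:
  fixes G :: "('a, 'b) monoid_scheme" and p :: nat and A :: "'a set"
  assumes "Factorial_Ring.prime p"
    and "finite_p_group p G"
    and "\<not> comm_group G"
    and "F_group G"
    and "A \<in> pverts (centralizer_graph G)"
  shows "[out_degree (with_proj (centralizer_graph G)) A = 0] (mod p)"
proof -
  have grp: "group G" and fin: "finite (carrier G)"
    using assms(2) by (auto simp: finite_p_group_def)
  let ?Z = "\<lambda>B. group_center (G\<lparr>carrier := B\<rparr>)"
  let ?N = "{B. (A, B) \<in> parcs (centralizer_graph G)}"
  have A: "A \<in> centralizers G" using assms(5) by (simp add: centralizer_graph_def)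
  have subZ: "subgroup (group_center G) G"
    using subgroup_center_of_subgroup[OF grp group.subgroup_self[OF grp]] by simp
  note dvd = p_group_dvd_card_proper[OF assms(1,2) subZ]
  have vertex: "subgroup B G \<and> subgroup (?Z B) G \<and> group_center G \<subset> ?Z B \<and> ?Z B \<subseteq> B"
    if B: "B \<in> centralizers G" for B
  proof -
    obtain h where h: "h \<in> carrier G" "h \<notin> group_center G" "B = elt_centralizer G h"
      using B by (auto simp: centralizers_def)
    then have "subgroup B G" using subgroup_elt_centralizer[OF grp] by simp
    moreover have "group_center G \<subset> ?Z B"
      using h group_center_subset_center_centralizer[of h G] elt_in_center_centralizer[of h G] by blast
    ultimately show ?thesis
      using subgroup_center_of_subgroup[OF grp] by (auto simp: group_center_def)
  qed
  have "p * card (group_center G) dvd card (?Z A) + (\<Sum>B\<in>?N. card (?Z B))"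
    using dvd vertex A by (auto intro!: dvd_add dvd_sum simp: centralizer_graph_def)
  then have "p * card (group_center G) dvd card A + card ?N * card (group_center G)"
    using F_group_vertex_count[OF assms(4) fin A] by simp
  moreover have "p * card (group_center G) dvd card A"
    using dvd[of A] vertex[OF A] by blast
  ultimately have "p * card (group_center G) dvd card ?N * card (group_center G)"
    by (simp add: dvd_add_right_iff)
  moreover have "card (group_center G) \<noteq> 0"
    using subgroup.finite_imp_card_positive[OF subZ fin] by simp
  ultimately have "p dvd card ?N" by simp
  moreover have "out_arcs (with_proj (centralizer_graph G)) A = Pair A ` ?N"
    by (auto simp: out_arcs_def)
  then have "out_degree (with_proj (centralizer_graph G)) A = card ?N"
    by (simp add: out_degree_def card_image inj_on_def)
  ultimately show ?thesis by (simp add: cong_0_iff)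
qed

end
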